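(* Let $k$ be a field. The category of finite-dimensional vector spaces over $k$ and linear maps has alternation diameter $3$. More precisely, for any finite-dimensional vector spaces $A$ and $B$ over $k$, the group $G = \mathrm{Aut}(A \times B) = \mathrm{GL}(A \times B)$ satisfies $G = G_L G_R G_L = G_R G_L G_R$.
   Context: For a category-theoretic product $A \times B$ with projections $\pi_A : A \times B \to A$, $\pi_B : A \times B \to B$ (here, the direct product of vector spaces), let $G = \mathrm{Aut}(A \times B)$, $G_L = \{ g \in G : \pi_B \circ g = \pi_B \}$ and $G_R = \{ g \in G : \pi_A \circ g = \pi_A \}$; these are subgroups of $G$. For subsets $H, K$ of a group, $HK = \{hk : h \in H, k \in K\}$. If $G_L \cup G_R$ generates $G$, the alternation diameter of $A \times B$ is the least $d \in \mathbb{N}$ such that every element of $G$ is a product of at most $d$ elements of $G_L \cup G_R$ ($\infty$ if there is no such $d$); otherwise it is undefined. The alternation diameter of a category is the least upper bound of the alternation diameters of all products in it (undefined if some product has undefined alternation diameter). *)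

theory Defs
  imports "Jordan_Normal_Form.Missing_VectorSpace" "HOL-Algebra.Bij"
    "HOL-Algebra.Generated_Groups" "HOL-Library.Extended_Nat"
begin

text \<open>The elements are the bijective linear endomorphisms of \<open>V\<close>, extended by
  \<open>undefined\<close> outside the carrier so that equality of maps is equality in HOL.\<close>

definition linear_aut_group ::
    "('a, 'r) ring_scheme \<Rightarrow> ('a, 'v) module \<Rightarrow> ('v \<Rightarrow> 'v) monoid" where
  "linear_aut_group K V =
     BijGroup (carrier V) \<lparr>carrier := LinearCombinations.module_hom K V V \<inter> Bij (carrier V)\<rparr>"

text \<open>The library's \<open>direct_sum\<close> is the binary product: its carrier is
  \<open>carrier A \<times> carrier B\<close> with componentwise operations, and the projections are
  \<open>fst\<close> and \<open>snd\<close>.\<close>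

definition aut_prod ::
    "('a, 'r) ring_scheme \<Rightarrow> ('a, 'b) module \<Rightarrow> ('a, 'c) module
      \<Rightarrow> ('b \<times> 'c \<Rightarrow> 'b \<times> 'c) monoid" where
  "aut_prod K A B = linear_aut_group K (direct_sum A B)"

definition aut_left ::
    "('a, 'r) ring_scheme \<Rightarrow> ('a, 'b) module \<Rightarrow> ('a, 'c) module
      \<Rightarrow> ('b \<times> 'c \<Rightarrow> 'b \<times> 'c) set" where
  "aut_left K A B =
     {g \<in> carrier (aut_prod K A B). \<forall>x \<in> carrier (direct_sum A B). snd (g x) = snd x}"

definition aut_right ::
    "('a, 'r) ring_scheme \<Rightarrow> ('a, 'b) module \<Rightarrow> ('a, 'c) module
      \<Rightarrow> ('b \<times> 'c \<Rightarrow> 'b \<times> 'c) set" where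
  "aut_right K A B =
     {g \<in> carrier (aut_prod K A B). \<forall>x \<in> carrier (direct_sum A B). fst (g x) = fst x}"

text \<open>\<^term>\<open>None\<close> stands for "undefined"; the infimum is
  \<^term>\<open>\<infinity> :: enat\<close> if no bound \<open>d\<close> exists.\<close>

definition alternation_diameter ::
    "('a, 'r) ring_scheme \<Rightarrow> ('a, 'b) module \<Rightarrow> ('a, 'c) module \<Rightarrow> enat option" where
  "alternation_diameter K A B =
     (let G = aut_prod K A B; S = aut_left K A B \<union> aut_right K A B in
      if generate G S = carrier G
      then Some (Inf {enat d | d. \<forall>g \<in> carrier G. \<exists>gs. set gs \<subseteq> S \<and> length gs \<le> d
                                    \<and> g = foldr (mult G) gs \<one>\<^bsub>G\<^esub>})
      else None)"

definition fin_dim_spaces :: "('a, 'r) ring_scheme \<Rightarrow> ('a, 'v) module set" where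
  "fin_dim_spaces K = {V. vectorspace K V \<and> vectorspace.fin_dim K V}"

text \<open>The alternation diameter of the category of \<open>K\<close>-linear maps between the spaces
  in \<open>\<C>\<close>.\<close>

definition category_alternation_diameter ::
    "('a, 'r) ring_scheme \<Rightarrow> ('a, 'v) module set \<Rightarrow> enat option" where
  "category_alternation_diameter K \<C> =
     (if \<exists>A \<in> \<C>. \<exists>B \<in> \<C>. alternation_diameter K A B = None then None
      else Some (SUP (A, B) \<in> \<C> \<times> \<C>. the (alternation_diameter K A B)))"

text \<open>HOL cannot quantify over types, so the objects of the category are the
  finite-dimensional spaces whose vectors are drawn from one type \<open>'u\<close>. The type has to be
  large enough for every isomorphism class to occur, i.e. for spaces of every finite dimension
  to exist. The lemma below shows that \<open>'u = nat \<Rightarrow> 'a\<close> is large enough for every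
  field with elements in \<open>'a\<close>.\<close>

definition universe_of_spaces :: "('a, 'r) ring_scheme \<Rightarrow> 'u itself \<Rightarrow> bool" where
  "universe_of_spaces K _ \<longleftrightarrow>
     (\<forall>n. \<exists>V \<in> (fin_dim_spaces K :: ('a, 'u) module set). vectorspace.dim K V = n)"

lemma universe_of_spaces_exists:
  fixes K :: "('a, 'r) ring_scheme"
  assumes "field K"
  shows "universe_of_spaces K TYPE(nat \<Rightarrow> 'a)"
  unfolding universe_of_spaces_def
proof
  fix n :: nat
  interpret field K by (rule assms)
  define V :: "('a, nat \<Rightarrow> 'a) module" where "V = func_space {..<n}"
  have V: "vectorspace K V"
    unfolding vectorspace_def V_def using func_space_is_module assms by blast
  interpret V: vectorspace K V by (rule V)
  have carr: "carrier V = {..<n} \<rightarrow>\<^sub>E carrier K"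
    and zeroV: "\<zero>\<^bsub>V\<^esub> = restrict (\<lambda>_. \<zero>\<^bsub>K\<^esub>) {..<n}"
    and addV: "\<And>f g. f \<oplus>\<^bsub>V\<^esub> g = restrict (\<lambda>j. f j \<oplus>\<^bsub>K\<^esub> g j) {..<n}"
    and smultV: "\<And>c f. c \<odot>\<^bsub>V\<^esub> f = restrict (\<lambda>j. c \<otimes>\<^bsub>K\<^esub> f j) {..<n}"
    by (simp_all add: V_def func_space_def)
  define e where "e i = restrict (\<lambda>j. if i = j then \<one>\<^bsub>K\<^esub> else \<zero>\<^bsub>K\<^esub>) {..<n}" for i
  define E where "E = e ` {..<n}"
  have inj: "inj_on e {..<n}"
  proof (rule inj_onI)
    fix i j assume ij: "i \<in> {..<n}" "j \<in> {..<n}" "e i = e j"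
    have "e i i = e j i" using ij(3) by (rule fun_cong)
    then show "i = j" using ij(1,2) by (simp add: e_def split: if_splits)
  qed
  have fin: "finite E" and card: "card E = n"
    using card_image[OF inj] by (auto simp: E_def)
  have E: "E \<subseteq> carrier V" by (auto simp: E_def e_def carr PiE_def extensional_def)
  have finsum_at: "finsum V F I j = finsum K (\<lambda>i. F i j) I"
    if "finite I" "F \<in> I \<rightarrow> carrier V" "j < n" for F and I :: "(nat \<Rightarrow> 'a) set" and j
    using that
  proof (induction I rule: finite_induct)
    case empty
    then show ?case by (simp add: zeroV)
  next
    case (insert x I)
    have "(\<lambda>i. F i j) \<in> insert x I \<rightarrow> carrier K"
      using insert.prems by (auto simp: carr Pi_iff PiE_iff)
    then show ?case using insert by (simp add: addV)
  qed
  have lincomb_at: "V.lincomb a E j = a (e j)" if a: "a \<in> E \<rightarrow> carrier K" and j: "j < n" for a j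
  proof -
    have ejE: "e j \<in> E" using j by (simp add: E_def)
    have F: "(\<lambda>v. a v \<odot>\<^bsub>V\<^esub> v) \<in> E \<rightarrow> carrier V"
      using a E by (auto intro!: V.smult_closed)
    have "V.lincomb a E j = finsum K (\<lambda>v. (a v \<odot>\<^bsub>V\<^esub> v) j) E"
      unfolding V.lincomb_def by (rule finsum_at[OF fin F j])
    also have "\<dots> = finsum K (\<lambda>v. if e j = v then a v else \<zero>\<^bsub>K\<^esub>) E"
    proof (rule finsum_cong'[OF refl])
      show "(\<lambda>v. if e j = v then a v else \<zero>\<^bsub>K\<^esub>) \<in> E \<rightarrow> carrier K"
        using a by auto
      fix v assume v: "v \<in> E"
      then obtain i where i: "i < n" "v = e i" by (auto simp: E_def)
      have "a v \<in> carrier K" using a v by auto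
      moreover have "e j = e i \<longleftrightarrow> j = i" using inj i j by (auto simp: inj_on_def)
      ultimately show "(a v \<odot>\<^bsub>V\<^esub> v) j = (if e j = v then a v else \<zero>\<^bsub>K\<^esub>)"
        using i j by (auto simp: smultV e_def)
    qed
    also have "\<dots> = a (e j)" by (rule finsum_singleton[OF ejE fin a])
    finally show ?thesis .
  qed
  have "V.basis E"
  proof (rule V.basis_criterion[OF fin E, THEN iffD2], intro allI impI)
    fix v assume v: "v \<in> carrier V"
    define a where "a = restrict (\<lambda>w. v (inv_into {..<n} e w)) E"
    have aE: "a \<in> E \<rightarrow>\<^sub>E carrier K"
      unfolding a_def
    proof (rule restrict_PiE_iff[THEN iffD2], rule ballI)
      fix w assume "w \<in> E"
      then have "inv_into {..<n} e w \<in> {..<n}" unfolding E_def by (rule inv_into_into)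
      with v show "v (inv_into {..<n} e w) \<in> carrier K" unfolding carr by (rule PiE_mem)
    qed
    show "\<exists>!a. a \<in> E \<rightarrow>\<^sub>E carrier K \<and> V.lincomb a E = v"
    proof (rule ex1I[of _ a])
      have "V.lincomb a E = v"
      proof (rule PiE_ext)
        have "a \<in> E \<rightarrow> carrier K" using aE by (simp add: PiE_def)
        then show "V.lincomb a E \<in> {..<n} \<rightarrow>\<^sub>E carrier K"
          unfolding carr[symmetric] by (rule V.lincomb_closed[OF E])
        show "v \<in> {..<n} \<rightarrow>\<^sub>E carrier K" using v unfolding carr .
        fix j assume j: "j \<in> {..<n}"
        have "V.lincomb a E j = a (e j)"
          using j by (intro lincomb_at[OF \<open>a \<in> E \<rightarrow> carrier K\<close>]) simp
        also have "\<dots> = v j"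
          using j by (simp only: a_def E_def restrict_apply' imageI inv_into_f_f[OF inj])
        finally show "V.lincomb a E j = v j" .
      qed
      with aE show "a \<in> E \<rightarrow>\<^sub>E carrier K \<and> V.lincomb a E = v" by blast
      fix b assume b: "b \<in> E \<rightarrow>\<^sub>E carrier K \<and> V.lincomb b E = v"
      have bE: "b \<in> E \<rightarrow>\<^sub>E carrier K" and bv: "V.lincomb b E = v" using b by auto
      show "b = a"
      proof (rule PiE_ext[OF bE aE])
        fix w assume "w \<in> E"
        then obtain j where j: "j < n" "w = e j" by (auto simp: E_def)
        have "b \<in> E \<rightarrow> carrier K" "a \<in> E \<rightarrow> carrier K"
          using aE bE by (simp_all add: PiE_def)
        then have "v j = b w" "v j = a w"
          using lincomb_at[of b j, unfolded bv] lincomb_at[of a j, unfolded \<open>V.lincomb a E = v\<close>] j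
          by simp_all
        then show "b w = a w" by simp
      qed
    qed
  qed
  then have dim: "V.dim = n" and gen: "V.gen_set E"
    using V.dim_basis[OF fin] card unfolding V.basis_def by metis+
  then have "V.fin_dim" using fin E unfolding V.fin_dim_def by blast
  then have "V \<in> fin_dim_spaces K" using V by (simp add: fin_dim_spaces_def)
  with dim show "\<exists>V \<in> (fin_dim_spaces K :: ('a, nat \<Rightarrow> 'a) module set). vectorspace.dim K V = n"
    by (rule bexI)
qed

end

theory Submission
  imports Defs
begin

text \<open>Write an automorphism \<open>g\<close> of \<open>A \<times> B\<close> as a block matrix whose lower row is \<open>(c, d)\<close>. As \<open>g\<close> is
  onto, \<open>(c, d) : A \<times> B \<rightarrow> B\<close> is onto, and hence some linear \<open>b : B \<rightarrow> A\<close> makes \<open>c b + d\<close>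
  bijective: if \<open>b\<close> maximises the rank of \<open>e = c b + d\<close> and \<open>e\<close> is not onto, take \<open>y \<noteq> 0\<close> in the
  kernel of \<open>e\<close>, an \<open>a\<close> with \<open>c a\<close> outside the image of \<open>e\<close> and a functional \<open>f\<close> with \<open>f y = 1\<close>;
  then \<open>b + f a\<close> gives a larger rank. With \<open>l (x, y) = (x + b y, y)\<close> and
  \<open>r (x, y) = (x, snd (g (l (x, y))))\<close> the map \<open>r\<close> is invertible and \<open>g l r\<inverse>\<close> preserves the
  second component, so \<open>g = (g l r\<inverse>) r l\<inverse>\<close> lies in \<open>G\<^sub>L G\<^sub>R G\<^sub>L\<close>.

  The swap of \<open>V \<times> V\<close> with \<open>V \<noteq> 0\<close> is neither in \<open>G\<^sub>L G\<^sub>R\<close> nor in \<open>G\<^sub>R G\<^sub>L\<close>: if it were \<open>l r\<close>,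
  then \<open>r (0, v) = (0, snd (v, 0)) = 0\<close> for all \<open>v\<close>.\<close>

section \<open>Linear maps between finite-dimensional spaces\<close>

text \<open>Independent subsets of \<open>W\<close> are independent in \<open>V\<close>, hence of
  size at most \<open>dim\<close>, so a maximal one exists and is a basis of \<open>vs W\<close>.
  Independence and span are stated in \<open>V\<close>, where they can be compared with bases of the
  whole space.\<close>

lemma (in vectorspace) subspace_basis_exists:
  assumes "fin_dim" and W: "VectorSpace.subspace K W V"
  obtains S where "finite S" "S \<subseteq> W" "lin_indpt S" "span S = W" "vectorspace.dim K (vs W) = card S"
proof -
  interpret W: vectorspace K "vs W" using W by (rule subspace_is_vs)
  have sub: "submodule K W V" using W by simp
  then have WV: "W \<subseteq> carrier V" by (simp add: submodule_def)
  have li: "W.lin_indpt S \<longleftrightarrow> lin_indpt S" and sp: "W.span S = span S" if "S \<subseteq> W" for S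
    using span_li_not_depend[OF that sub] by auto
  obtain S where fin: "finite S" and max: "maximal S (\<lambda>S. S \<subseteq> carrier (vs W) \<and> W.lin_indpt S)"
  proof -
    have "finite S \<and> card S \<le> dim" if "S \<subseteq> carrier (vs W) \<and> W.lin_indpt S" for S
      using that li li_le_dim[OF assms(1), of S] WV by auto
    moreover have "{} \<subseteq> carrier (vs W) \<and> W.lin_indpt {}"
      using W.finite_lin_indpt2[of "{}"] by simp
    ultimately show ?thesis
      using maximal_exists[of "\<lambda>S. S \<subseteq> carrier (vs W) \<and> W.lin_indpt S" dim "{}"] that by blast
  qed
  have basis: "W.basis S" using max by (rule W.max_li_is_basis)
  then have "S \<subseteq> W" "W.lin_indpt S" "W.span S = W" by (auto simp: W.basis_def)
  then show ?thesis
    using that[of S] fin li sp W.dim_basis[OF fin basis] by simp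
qed

lemma (in linear_map) dim_image_inj:
  assumes "V.fin_dim" "inj_on T (carrier V)"
  shows "vectorspace.dim K (W.vs imT) = V.dim"
  using rank_nullity[OF assms(1)] inj_imp_dim_ker0[OF assms(2)] by simp

text \<open>Injectivity gives the image the dimension of \<open>V\<close>; a basis of the image is
  then an independent set of size \<open>W.dim\<close>, hence a basis of \<open>W\<close>.\<close>

lemma (in linear_map) inj_imp_surj_dim:
  assumes "V.fin_dim" "W.fin_dim" "V.dim = W.dim" "inj_on T (carrier V)"
  shows "T ` carrier V = carrier W"
proof -
  obtain S where S: "finite S" "S \<subseteq> imT" "W.module.lin_indpt S" "W.module.span S = imT"
      "vectorspace.dim K (W.vs imT) = card S"
    using W.subspace_basis_exists[OF assms(2) imT_is_subspace] .
  have "imT \<subseteq> carrier W" by (auto simp: im_def)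
  then have "W.basis S"
    using S assms dim_image_inj by (intro W.dim_li_is_basis) auto
  then have "imT = carrier W" using S(4) by (simp add: W.basis_def)
  then show ?thesis by (simp add: im_def)
qed

text \<open>Rank-nullity leaves dimension 0 for the kernel, so a basis of the kernel is empty and
  spans only zero.\<close>

lemma (in linear_map) surj_imp_inj_dim:
  assumes "V.fin_dim" "V.dim = W.dim" "T ` carrier V = carrier W"
  shows "inj_on T (carrier V)"
proof -
  obtain S where S: "finite S" "V.module.span S = kerT" "vectorspace.dim K (V.vs kerT) = card S"
    using V.subspace_basis_exists[OF assms(1) kerT_is_subspace] .
  have "imT = carrier W" using assms(3) by (simp add: im_def)
  then have "card S = 0"
    using rank_nullity[OF assms(1)] S(3) assms(2) by simp
  then have "kerT = {\<zero>\<^bsub>V\<^esub>}" using S V.span_empty by simp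
  then show ?thesis by (intro Ke0_imp_inj) simp
qed

text \<open>\<open>f\<close> is the coordinate at a basis vector where \<open>y\<close> has a
  nonzero coordinate, rescaled to give 1 on \<open>y\<close>. Its values lie in \<open>K\<close>, a
  ring record and not a module record, so linearity is written out instead of using
  \<open>module_hom\<close>.\<close>

lemma (in vectorspace) separating_functional_exists:
  assumes "fin_dim" and y: "y \<in> carrier V" "y \<noteq> \<zero>\<^bsub>V\<^esub>"
  obtains f where "f \<in> carrier V \<rightarrow> carrier K"
    "\<And>u v. u \<in> carrier V \<Longrightarrow> v \<in> carrier V \<Longrightarrow> f (u \<oplus>\<^bsub>V\<^esub> v) = f u \<oplus>\<^bsub>K\<^esub> f v"
    "\<And>c v. c \<in> carrier K \<Longrightarrow> v \<in> carrier V \<Longrightarrow> f (c \<odot>\<^bsub>V\<^esub> v) = c \<otimes>\<^bsub>K\<^esub> f v"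
    "f y = \<one>\<^bsub>K\<^esub>"
proof -
  obtain X where fin: "finite X" and X: "basis X" using finite_basis_exists[OF assms(1)] by blast
  then have XV: "X \<subseteq> carrier V" by (simp add: basis_def)
  have ex1: "\<exists>!a. a \<in> X \<rightarrow>\<^sub>E carrier K \<and> lincomb a X = v" if "v \<in> carrier V" for v
    using basis_criterion[OF fin XV] X that by blast
  define coord where "coord v = (THE a. a \<in> X \<rightarrow>\<^sub>E carrier K \<and> lincomb a X = v)" for v
  have coord: "coord v \<in> X \<rightarrow>\<^sub>E carrier K \<and> lincomb (coord v) X = v" if "v \<in> carrier V" for v
    unfolding coord_def using ex1[OF that] by (rule theI')
  have closed: "coord v x \<in> carrier K" if "v \<in> carrier V" "x \<in> X" for v x
    using coord[OF that(1)] that(2) by (auto simp: PiE_iff)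
  \<comment> \<open>Coordinates are unique only among functions extensional on \<open>X\<close>, so
    \<open>a\<close> is first restricted to \<open>X\<close>, which leaves the linear combination
    unchanged.\<close>
  have uniq: "coord (lincomb a X) x = a x" if "a \<in> X \<rightarrow> carrier K" "x \<in> X" for a x
  proof -
    have "lincomb (restrict a X) X = lincomb a X"
      unfolding lincomb_def using that(1) XV by (intro finsum_cong') auto
    moreover have "restrict a X \<in> X \<rightarrow>\<^sub>E carrier K" using that(1) by auto
    moreover have "lincomb a X \<in> carrier V" using that(1) XV by (intro lincomb_closed)
    ultimately have "coord (lincomb a X) = restrict a X" using ex1 coord by blast
    then show ?thesis using that(2) by simp
  qed
  have "\<exists>x \<in> X. coord y x \<noteq> \<zero>\<^bsub>K\<^esub>"
  proof (rule ccontr)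
    assume "\<not> ?thesis"
    then have "lincomb (coord y) X = \<zero>\<^bsub>V\<^esub>" using XV by (intro lincomb_zero) auto
    with coord y show False by auto
  qed
  then obtain x where x: "x \<in> X" "coord y x \<noteq> \<zero>\<^bsub>K\<^esub>" by blast
  define k where "k = inv\<^bsub>K\<^esub> (coord y x)"
  have unit: "coord y x \<in> Units K" using closed y x field_Units by blast
  have k: "k \<in> carrier K" "k \<otimes>\<^bsub>K\<^esub> coord y x = \<one>\<^bsub>K\<^esub>"
    using unit by (auto simp: k_def)
  have coord_Pi: "coord v \<in> X \<rightarrow> carrier K" if "v \<in> carrier V" for v
    using coord[OF that] by (auto simp: PiE_iff)
  show ?thesis
  proof (rule that[of "\<lambda>v. k \<otimes>\<^bsub>K\<^esub> coord v x"])
    show "(\<lambda>v. k \<otimes>\<^bsub>K\<^esub> coord v x) \<in> carrier V \<rightarrow> carrier K"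
      using k closed x by auto
    show "k \<otimes>\<^bsub>K\<^esub> coord y x = \<one>\<^bsub>K\<^esub>" by (rule k)
  next
    fix u v assume uv: "u \<in> carrier V" "v \<in> carrier V"
    have "u \<oplus>\<^bsub>V\<^esub> v = lincomb (\<lambda>w. coord u w \<oplus>\<^bsub>K\<^esub> coord v w) X"
      using lincomb_sum[OF fin XV coord_Pi coord_Pi] coord uv by simp
    then have "coord (u \<oplus>\<^bsub>V\<^esub> v) x = coord u x \<oplus>\<^bsub>K\<^esub> coord v x"
      using uniq[of "\<lambda>w. coord u w \<oplus>\<^bsub>K\<^esub> coord v w"] closed uv x by auto
    then show "k \<otimes>\<^bsub>K\<^esub> coord (u \<oplus>\<^bsub>V\<^esub> v) x = (k \<otimes>\<^bsub>K\<^esub> coord u x) \<oplus>\<^bsub>K\<^esub> (k \<otimes>\<^bsub>K\<^esub> coord v x)"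
      using k closed uv x by (simp add: r_distr)
  next
    fix c v assume cv: "c \<in> carrier K" "v \<in> carrier V"
    have "c \<odot>\<^bsub>V\<^esub> v = lincomb (\<lambda>w. c \<otimes>\<^bsub>K\<^esub> coord v w) X"
      using lincomb_smult[OF XV coord_Pi] coord cv by simp
    then have "coord (c \<odot>\<^bsub>V\<^esub> v) x = c \<otimes>\<^bsub>K\<^esub> coord v x"
      using uniq[of "\<lambda>w. c \<otimes>\<^bsub>K\<^esub> coord v w"] closed cv x by auto
    then show "k \<otimes>\<^bsub>K\<^esub> coord (c \<odot>\<^bsub>V\<^esub> v) x = c \<otimes>\<^bsub>K\<^esub> (k \<otimes>\<^bsub>K\<^esub> coord v x)"
      using k closed cv x by (simp add: m_lcomm)
  qed
qed

section \<open>Calculus of module homomorphisms\<close>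

lemma module_homI:
  assumes "\<And>x. x \<in> carrier M \<Longrightarrow> f x \<in> carrier N"
    "\<And>x y. x \<in> carrier M \<Longrightarrow> y \<in> carrier M \<Longrightarrow> f (x \<oplus>\<^bsub>M\<^esub> y) = f x \<oplus>\<^bsub>N\<^esub> f y"
    "\<And>r x. r \<in> carrier R \<Longrightarrow> x \<in> carrier M \<Longrightarrow> f (r \<odot>\<^bsub>M\<^esub> x) = r \<odot>\<^bsub>N\<^esub> f x"
  shows "f \<in> LinearCombinations.module_hom R M N"
  using assms by (auto simp: LinearCombinations.module_hom_def)

lemma module_homD:
  assumes "f \<in> LinearCombinations.module_hom R M N" "x \<in> carrier M"
  shows "f x \<in> carrier N"
    "y \<in> carrier M \<Longrightarrow> f (x \<oplus>\<^bsub>M\<^esub> y) = f x \<oplus>\<^bsub>N\<^esub> f y"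
    "r \<in> carrier R \<Longrightarrow> f (r \<odot>\<^bsub>M\<^esub> x) = r \<odot>\<^bsub>N\<^esub> f x"
  using assms by (auto simp: LinearCombinations.module_hom_def)

text \<open>Group elements are \<open>undefined\<close> outside the carrier; this passes linearity
  from a formula to its restriction.\<close>

lemma module_hom_cong:
  assumes "Module.module R M" "f \<in> LinearCombinations.module_hom R M N"
    "\<And>x. x \<in> carrier M \<Longrightarrow> g x = f x"
  shows "g \<in> LinearCombinations.module_hom R M N"
proof -
  interpret Module.module R M by fact
  show ?thesis
    using assms(2,3) by (intro module_homI) (simp_all add: module_homD)
qed

lemma module_hom_comp:
  assumes "f \<in> LinearCombinations.module_hom R M N" "g \<in> LinearCombinations.module_hom R N P"
  shows "(\<lambda>x. g (f x)) \<in> LinearCombinations.module_hom R M P"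
  using assms by (intro module_homI) (simp_all add: module_homD)

lemma module_hom_zero:
  assumes "Module.module R M" "Module.module R N" "f \<in> LinearCombinations.module_hom R M N"
  shows "f \<zero>\<^bsub>M\<^esub> = \<zero>\<^bsub>N\<^esub>"
  using assms by (intro mod_hom.f0_is_0[of R]) (simp add: mod_hom_def mod_hom_axioms_def)

lemma module_hom_plus:
  assumes "Module.module R N" "f \<in> LinearCombinations.module_hom R M N"
    "g \<in> LinearCombinations.module_hom R M N"
  shows "(\<lambda>x. f x \<oplus>\<^bsub>N\<^esub> g x) \<in> LinearCombinations.module_hom R M N"
proof -
  interpret Module.module R N by fact
  show ?thesis
    using assms(2,3) by (intro module_homI) (simp_all add: module_homD M.a_ac smult_r_distr)
qed

lemma linear_mapI:
  assumes "vectorspace K V" "vectorspace K W" "f \<in> LinearCombinations.module_hom K V W"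
  shows "linear_map K V W f"
  using assms by (simp add: linear_map_def mod_hom_def mod_hom_axioms_def vectorspace_def)

text \<open>\<open>onto\<close> is surjectivity of the row \<open>(c, d)\<close>, and
  \<open>c b + d\<close> is the lower right block that results from composing with the shear by
  \<open>b\<close>.\<close>

lemma shear_exists:
  assumes A: "vectorspace K A" and B: "vectorspace K B" and fd: "vectorspace.fin_dim K B"
    and c: "c \<in> LinearCombinations.module_hom K A B"
    and d: "d \<in> LinearCombinations.module_hom K B B"
    and onto: "\<And>w. w \<in> carrier B \<Longrightarrow> \<exists>a \<in> carrier A. \<exists>y \<in> carrier B. w = c a \<oplus>\<^bsub>B\<^esub> d y"
  obtains b where "b \<in> LinearCombinations.module_hom K B A"
    "bij_betw (\<lambda>y. c (b y) \<oplus>\<^bsub>B\<^esub> d y) (carrier B) (carrier B)"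
proof -
  interpret A: vectorspace K A by fact
  interpret B: vectorspace K B by fact
  define e where "e b y = c (b y) \<oplus>\<^bsub>B\<^esub> d y" for b y
  have e_hom: "e b \<in> LinearCombinations.module_hom K B B"
    if "b \<in> LinearCombinations.module_hom K B A" for b
    unfolding e_def
    using module_hom_plus[OF B.module_axioms module_hom_comp[OF that c] d] .
  \<comment> \<open>\<open>P n\<close> says that some \<open>b\<close> gives rank at least
    \<open>n\<close>, witnessed by independent vectors in the image. As such \<open>n\<close> are
    bounded by \<open>B.dim\<close>, a greatest one exists and stands for the maximal rank.\<close>
  define P where "P n \<longleftrightarrow> (\<exists>b S. b \<in> LinearCombinations.module_hom K B A \<and> finite S \<and>
    S \<subseteq> e b ` carrier B \<and> B.lin_indpt S \<and> card S = n)" for n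
  have zero: "(\<lambda>y. \<zero>\<^bsub>A\<^esub>) \<in> LinearCombinations.module_hom K B A"
    by (intro module_homI) simp_all
  have "P 0"
    unfolding P_def using zero B.finite_lin_indpt2[of "{}"]
    by (intro exI[of _ "\<lambda>y. \<zero>\<^bsub>A\<^esub>"] exI[of _ "{}"]) simp
  have bound: "n \<le> B.dim" if "P n" for n
  proof -
    obtain b S where bS: "b \<in> LinearCombinations.module_hom K B A" "S \<subseteq> e b ` carrier B"
      "B.lin_indpt S" "card S = n" using \<open>P n\<close> by (auto simp: P_def)
    then have "S \<subseteq> carrier B" using e_hom[OF bS(1)] by (auto simp: module_homD)
    then show ?thesis using B.li_le_dim(2)[OF fd] bS by blast
  qed
  define n where "n = (GREATEST n. P n)"
  have n: "P n" "\<And>m. P m \<Longrightarrow> m \<le> n"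
    unfolding n_def using GreatestI_nat[of P, OF \<open>P 0\<close>] Greatest_le_nat[of P] bound by blast+
  then obtain b S where b: "b \<in> LinearCombinations.module_hom K B A" and S: "finite S"
    "S \<subseteq> e b ` carrier B" "B.lin_indpt S" "card S = n" by (auto simp: P_def)
  interpret E: linear_map K B B "e b" by (rule linear_mapI[OF B B e_hom[OF b]])
  have surj: "e b ` carrier B = carrier B"
  proof (rule ccontr)
    assume nsurj: "e b ` carrier B \<noteq> carrier B"
    then have "\<not> inj_on (e b) (carrier B)" using E.inj_imp_surj_dim[OF fd fd] by blast
    then have "E.ker \<noteq> {\<zero>\<^bsub>B\<^esub>}" using E.Ke0_imp_inj by auto
    moreover have "\<zero>\<^bsub>B\<^esub> \<in> E.ker" by (simp add: E.ker_def)
    ultimately obtain y where "y \<in> E.ker" "y \<noteq> \<zero>\<^bsub>B\<^esub>" by blast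
    then have y: "y \<in> carrier B" "y \<noteq> \<zero>\<^bsub>B\<^esub>" "e b y = \<zero>\<^bsub>B\<^esub>"
      by (simp_all add: E.ker_def)
    \<comment> \<open>If every \<open>c a\<close> lay in the image of \<open>e b\<close>, so would
      each \<open>d z = e b z - c (b z)\<close>, and \<open>onto\<close> would make
      \<open>e b\<close> surjective.\<close>
    have "\<exists>a \<in> carrier A. c a \<notin> e b ` carrier B"
    proof (rule ccontr)
      assume "\<not> ?thesis"
      then have ca: "\<And>a. a \<in> carrier A \<Longrightarrow> c a \<in> E.im" by (simp add: E.im_def)
      have sub: "submodule K E.im B" by (rule E.im_is_submodule)
      have "w \<in> E.im" if w: "w \<in> carrier B" for w
      proof -
        obtain a z where az: "a \<in> carrier A" "z \<in> carrier B" "w = c a \<oplus>\<^bsub>B\<^esub> d z"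
          using onto[OF w] by blast
        have cl: "b z \<in> carrier A" "c a \<in> carrier B" "c (b z) \<in> carrier B" "d z \<in> carrier B"
          using b c d az by (simp_all add: module_homD)
        then have "c (\<ominus>\<^bsub>A\<^esub> b z) = \<ominus>\<^bsub>B\<^esub> c (b z)"
          using mod_hom.f_neg[of K A B c "b z"] A.module_axioms B.module_axioms c
          by (simp add: mod_hom_def mod_hom_axioms_def)
        then have "w = c a \<oplus>\<^bsub>B\<^esub> (c (\<ominus>\<^bsub>A\<^esub> b z) \<oplus>\<^bsub>B\<^esub> e b z)"
          using cl az by (simp add: e_def B.M.r_neg2 B.M.r_neg1)
        moreover have "c a \<in> E.im" "c (\<ominus>\<^bsub>A\<^esub> b z) \<in> E.im" "e b z \<in> E.im"
          using ca az cl by (auto simp: E.im_def)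
        ultimately show ?thesis using sub by (simp add: submodule_def)
      qed
      then show False using nsurj by (auto simp: E.im_def)
    qed
    then obtain a where a: "a \<in> carrier A" "c a \<notin> e b ` carrier B" by blast
    then have ca: "c a \<in> carrier B" using c by (simp add: module_homD)
    obtain f where f: "f \<in> carrier B \<rightarrow> carrier K"
      "\<And>u v. u \<in> carrier B \<Longrightarrow> v \<in> carrier B \<Longrightarrow> f (u \<oplus>\<^bsub>B\<^esub> v) = f u \<oplus>\<^bsub>K\<^esub> f v"
      "\<And>k v. k \<in> carrier K \<Longrightarrow> v \<in> carrier B \<Longrightarrow> f (k \<odot>\<^bsub>B\<^esub> v) = k \<otimes>\<^bsub>K\<^esub> f v"
      "f y = \<one>\<^bsub>K\<^esub>"
      using B.separating_functional_exists[OF fd y(1,2)] by blast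
    have fK: "f v \<in> carrier K" if "v \<in> carrier B" for v using f(1) that by blast
    \<comment> \<open>A rank-one change of \<open>b\<close>: it adds \<open>f v\<close> times
      \<open>c a\<close> to \<open>e b v\<close>, so that \<open>y\<close>, formerly in the kernel,
      now maps to \<open>c a\<close>.\<close>
    define b' where "b' = (\<lambda>v. f v \<odot>\<^bsub>A\<^esub> a \<oplus>\<^bsub>A\<^esub> b v)"
    have "(\<lambda>v. f v \<odot>\<^bsub>A\<^esub> a) \<in> LinearCombinations.module_hom K B A"
      using a(1) f fK by (intro module_homI) (simp_all add: A.smult_l_distr A.smult_assoc1)
    then have b': "b' \<in> LinearCombinations.module_hom K B A"
      unfolding b'_def using b by (intro module_hom_plus[OF A.module_axioms])
    have e': "e b' v = f v \<odot>\<^bsub>B\<^esub> c a \<oplus>\<^bsub>B\<^esub> e b v" if "v \<in> carrier B" for v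
      using that fK[OF that] a(1) b c d by (simp add: e_def b'_def module_homD B.M.a_assoc)
    have "e b v \<in> e b' ` carrier B" if v: "v \<in> carrier B" for v
    proof -
      \<comment> \<open>Subtracting \<open>f v\<close> times the kernel vector \<open>y\<close>
        keeps the value of \<open>e b\<close> and makes \<open>f\<close> vanish, so
        \<open>e b'\<close> takes the old value at \<open>u\<close> and the old image
        survives.\<close>
      define u where "u = v \<oplus>\<^bsub>B\<^esub> (\<ominus>\<^bsub>K\<^esub> f v) \<odot>\<^bsub>B\<^esub> y"
      have u: "u \<in> carrier B" using v y fK by (simp add: u_def)
      have "f u = \<zero>\<^bsub>K\<^esub>" using v y f fK by (simp add: u_def A.R.r_neg)
      then have "e b' u = e b u" using e'[OF u] u ca by simp
      also have "\<dots> = e b v" using v y fK by (simp add: u_def)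
      finally show ?thesis using u by (metis imageI)
    qed
    moreover have "c a \<in> e b' ` carrier B"
      using e'[OF y(1)] y f(4) ca by (metis B.M.r_zero B.smult_one imageI)
    ultimately have S': "S \<union> {c a} \<subseteq> e b' ` carrier B" using S(2) by blast
    have SB: "S \<subseteq> carrier B" using S(2) e_hom[OF b] by (auto simp: module_homD)
    \<comment> \<open>The image of \<open>e b\<close> is a submodule containing \<open>S\<close>,
      hence \<open>c a\<close>, which lies outside it, can be added to \<open>S\<close> without
      losing independence.\<close>
    have "B.span S \<subseteq> e b ` carrier B"
      using B.span_is_subset[OF S(2)[folded E.im_def] E.im_is_submodule] by (simp add: E.im_def)
    then have nspan: "c a \<notin> B.span S" using a by blast
    then have nS: "c a \<notin> S" using B.in_own_span[OF SB] by blast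
    have "B.lin_indpt (S \<union> {c a})"
      using B.lin_dep_iff_in_span[OF SB S(3) ca nS] nspan by blast
    moreover have "card (S \<union> {c a}) = Suc n" using S nS by simp
    moreover have "finite (S \<union> {c a})" using S by simp
    ultimately have "P (Suc n)" unfolding P_def using b' S' by blast
    then show False using n(2) by fastforce
  qed
  have "bij_betw (e b) (carrier B) (carrier B)"
    using surj E.surj_imp_inj_dim[OF fd refl surj] by (simp add: bij_betw_def)
  then show ?thesis using that b by (simp add: e_def[abs_def])
qed

section \<open>Automorphisms of a biproduct\<close>

lemma linear_aut_group_simps:
  "carrier (linear_aut_group K V) = LinearCombinations.module_hom K V V \<inter> Bij (carrier V)"
  "\<one>\<^bsub>linear_aut_group K V\<^esub> = (\<lambda>x \<in> carrier V. x)"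
  by (simp_all add: linear_aut_group_def BijGroup_def)

lemma linear_aut_group_mult:
  assumes "f \<in> carrier (linear_aut_group K V)" "g \<in> carrier (linear_aut_group K V)"
  shows "f \<otimes>\<^bsub>linear_aut_group K V\<^esub> g = compose (carrier V) f g"
  using assms by (simp add: linear_aut_group_def BijGroup_def)

lemma linear_aut_groupD:
  assumes "f \<in> carrier (linear_aut_group K V)"
  shows "f \<in> LinearCombinations.module_hom K V V" "bij_betw f (carrier V) (carrier V)"
    "f \<in> extensional (carrier V)" "inj_on f (carrier V)"
    "x \<in> carrier V \<Longrightarrow> f x \<in> carrier V"
  using assms by (auto simp: linear_aut_group_simps Bij_def bij_betw_def)

lemma restrict_in_linear_aut_group:
  assumes "Module.module K V" "f \<in> LinearCombinations.module_hom K V V"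
    "bij_betw f (carrier V) (carrier V)"
  shows "restrict f (carrier V) \<in> carrier (linear_aut_group K V)"
  using assms module_hom_cong[OF assms(1,2), of "restrict f (carrier V)"]
  by (simp add: linear_aut_group_simps Bij_def)

text \<open>The automorphism group is \<open>BijGroup\<close> with a smaller carrier, so it inherits
  the group laws once that carrier is a subgroup.\<close>

lemma subgroup_linear_aut:
  assumes "Module.module K V"
  shows "subgroup (LinearCombinations.module_hom K V V \<inter> Bij (carrier V)) (BijGroup (carrier V))"
    (is "subgroup ?H ?G")
proof -
  interpret Module.module K V by fact
  show ?thesis
  proof (rule subgroup.intro)
    show "?H \<subseteq> carrier ?G" by (simp add: BijGroup_def)
    show "\<one>\<^bsub>?G\<^esub> \<in> ?H"
      by (auto simp: BijGroup_def id_Bij intro!: module_homI)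
  next
    fix f g assume fg: "f \<in> ?H" "g \<in> ?H"
    have "compose (carrier V) f g \<in> LinearCombinations.module_hom K V V"
      by (rule module_hom_cong[OF assms module_hom_comp[of g K V V f V]])
        (use fg in \<open>auto simp: compose_eq\<close>)
    then show "f \<otimes>\<^bsub>?G\<^esub> g \<in> ?H"
      using fg by (simp add: BijGroup_def compose_Bij)
  next
    fix f assume f: "f \<in> ?H"
    then have bij: "f \<in> Bij (carrier V)" and hom: "f \<in> LinearCombinations.module_hom K V V"
      by simp_all
    have r: "inv_into (carrier V) f x \<in> carrier V" "f (inv_into (carrier V) f x) = x"
      if "x \<in> carrier V" for x
      using that bij Bij_inv_into_mem[OF bij that]
      by (auto simp: Bij_def bij_betw_inv_into_right)
    \<comment> \<open>An identity for the inverse map can be checked after applying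
      \<open>f\<close>, by injectivity; this is how linearity passes to the inverse.\<close>
    have l: "inv_into (carrier V) f z = x" if "x \<in> carrier V" "z = f x" for x z
      using that bij bij_betw_inv_into_left[of f "carrier V" "carrier V" x] by (simp add: Bij_def)
    have "restrict (inv_into (carrier V) f) (carrier V) \<in> LinearCombinations.module_hom K V V"
      using hom r by (intro module_homI) (auto intro!: l simp: module_homD)
    then show "inv\<^bsub>?G\<^esub> f \<in> ?H"
      using bij by (simp add: inv_BijGroup restrict_inv_into_Bij del: restrict_apply)
  qed
qed

lemma group_linear_aut_group:
  assumes "Module.module K V"
  shows "group (linear_aut_group K V)"
  unfolding linear_aut_group_def
  by (rule subgroup.subgroup_is_group[OF subgroup_linear_aut[OF assms] group_BijGroup])

lemma linear_aut_group_mult_apply: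
  assumes "f \<in> carrier (linear_aut_group K V)" "g \<in> carrier (linear_aut_group K V)"
    "x \<in> carrier V"
  shows "(f \<otimes>\<^bsub>linear_aut_group K V\<^esub> g) x = f (g x)"
  using assms by (simp add: linear_aut_group_mult compose_eq)

lemma linear_aut_group_inv_apply:
  assumes V: "Module.module K V" and f: "f \<in> carrier (linear_aut_group K V)" and x: "x \<in> carrier V"
  shows "f ((inv\<^bsub>linear_aut_group K V\<^esub> f) x) = x"
proof -
  interpret G: group "linear_aut_group K V" by (rule group_linear_aut_group[OF V])
  show ?thesis
    using G.r_inv[OF f] linear_aut_group_mult_apply[OF f G.inv_closed[OF f] x] x
    by (simp add: linear_aut_group_simps)
qed

text \<open>With \<open>snd\<close> or \<open>fst\<close> for \<open>p\<close> on a direct sum these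
  are the two generating subgroups; a general \<open>p\<close> treats both at once.\<close>

definition stabilizing_auts ::
    "('a, 'r) ring_scheme \<Rightarrow> ('a, 'v) module \<Rightarrow> ('v \<Rightarrow> 'b) \<Rightarrow> ('v \<Rightarrow> 'v) set" where
  "stabilizing_auts K V p =
     {g \<in> carrier (linear_aut_group K V). \<forall>x \<in> carrier V. p (g x) = p x}"

lemma subgroup_stabilizing_auts:
  assumes "Module.module K V"
  shows "subgroup (stabilizing_auts K V p) (linear_aut_group K V)" (is "subgroup ?S ?G")
proof -
  interpret G: group ?G by (rule group_linear_aut_group[OF assms])
  show ?thesis
  proof (rule G.subgroupI)
    show "?S \<subseteq> carrier ?G" by (auto simp: stabilizing_auts_def)
    have "\<one>\<^bsub>?G\<^esub> \<in> ?S"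
      using G.one_closed by (simp add: stabilizing_auts_def) (simp add: linear_aut_group_simps)
    then show "?S \<noteq> {}" by blast
  next
    fix f assume "f \<in> ?S"
    then have f: "f \<in> carrier ?G" "\<And>x. x \<in> carrier V \<Longrightarrow> p (f x) = p x"
      by (auto simp: stabilizing_auts_def)
    have "p ((inv\<^bsub>?G\<^esub> f) x) = p x" if x: "x \<in> carrier V" for x
      using f(2)[of "(inv\<^bsub>?G\<^esub> f) x"] linear_aut_groupD(5)[OF G.inv_closed[OF f(1)] x]
        linear_aut_group_inv_apply[OF assms f(1) x] by simp
    then show "inv\<^bsub>?G\<^esub> f \<in> ?S" using f by (simp add: stabilizing_auts_def)
  next
    fix f g assume fg: "f \<in> ?S" "g \<in> ?S"
    then have "f \<in> carrier ?G" and g: "g \<in> carrier ?G" by (simp_all add: stabilizing_auts_def)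
    then have "f \<otimes>\<^bsub>?G\<^esub> g \<in> carrier ?G"
      "\<And>x. x \<in> carrier V \<Longrightarrow> (f \<otimes>\<^bsub>?G\<^esub> g) x = f (g x)"
      by (simp_all add: linear_aut_group_mult_apply)
    then show "f \<otimes>\<^bsub>?G\<^esub> g \<in> ?S"
      using fg linear_aut_groupD(5)[OF g] by (simp add: stabilizing_auts_def)
  qed
qed

text \<open>The biproduct is taken abstractly so that the factorization can be applied with the two
  factors in either order.\<close>

locale biproduct =
  V: vectorspace K V + A: vectorspace K A + B: vectorspace K B
  for K :: "('a, 'r) ring_scheme" and V :: "('a, 'v) module"
    and A :: "('a, 'b) module" and B :: "('a, 'c) module" +
  fixes p :: "'v \<Rightarrow> 'b" and q :: "'v \<Rightarrow> 'c" and i :: "'b \<Rightarrow> 'v" and j :: "'c \<Rightarrow> 'v"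
  assumes p: "p \<in> LinearCombinations.module_hom K V A"
    and q: "q \<in> LinearCombinations.module_hom K V B"
    and i: "i \<in> LinearCombinations.module_hom K A V"
    and j: "j \<in> LinearCombinations.module_hom K B V"
    and pi: "\<And>x. x \<in> carrier A \<Longrightarrow> p (i x) = x"
    and qi: "\<And>x. x \<in> carrier A \<Longrightarrow> q (i x) = \<zero>\<^bsub>B\<^esub>"
    and pj: "\<And>y. y \<in> carrier B \<Longrightarrow> p (j y) = \<zero>\<^bsub>A\<^esub>"
    and qj: "\<And>y. y \<in> carrier B \<Longrightarrow> q (j y) = y"
    and ip_jq: "\<And>v. v \<in> carrier V \<Longrightarrow> i (p v) \<oplus>\<^bsub>V\<^esub> j (q v) = v"
begin

lemmas hom_simps = module_homD[OF p] module_homD[OF q] module_homD[OF i] module_homD[OF j]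
  module_hom_zero[OF V.module_axioms A.module_axioms p]
  module_hom_zero[OF V.module_axioms B.module_axioms q]
  module_hom_zero[OF A.module_axioms V.module_axioms i]
  module_hom_zero[OF B.module_axioms V.module_axioms j]
  pi qi pj qj

lemma eqI:
  assumes "u \<in> carrier V" "v \<in> carrier V" "p u = p v" "q u = q v"
  shows "u = v"
  using ip_jq[OF assms(1)] ip_jq[OF assms(2)] unfolding assms(3,4) by (rule trans[OF sym])

lemma bij_betwI:
  assumes T: "T \<in> LinearCombinations.module_hom K V V"
    and inj: "\<And>v. v \<in> carrier V \<Longrightarrow> T v = \<zero>\<^bsub>V\<^esub> \<Longrightarrow> v = \<zero>\<^bsub>V\<^esub>"
    and surj: "\<And>w. w \<in> carrier V \<Longrightarrow> \<exists>v \<in> carrier V. T v = w"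
  shows "bij_betw T (carrier V) (carrier V)"
proof -
  interpret T: linear_map K V V T
    by (rule linear_mapI[OF V.vectorspace_axioms V.vectorspace_axioms T])
  have "T.ker = {\<zero>\<^bsub>V\<^esub>}" using inj by (auto simp: T.ker_def)
  then have "inj_on T (carrier V)" by (intro T.Ke0_imp_inj) simp
  moreover have "T ` carrier V = carrier V"
    using surj T by (force simp: module_homD)
  ultimately show ?thesis by (simp add: bij_betw_def)
qed

text \<open>In block form, shearing \<open>g\<close> on the right makes the lower right entry of the
  product invertible; a lower triangular \<open>r\<close> then absorbs the whole lower row, and what
  is left fixes \<open>q\<close>.\<close>

lemma factorization:
  assumes fd: "B.fin_dim" and g: "g \<in> carrier (linear_aut_group K V)"
  obtains l r l' where "l \<in> stabilizing_auts K V q" "r \<in> stabilizing_auts K V p"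
    "l' \<in> stabilizing_auts K V q"
    "g = l \<otimes>\<^bsub>linear_aut_group K V\<^esub> r \<otimes>\<^bsub>linear_aut_group K V\<^esub> l'"
proof -
  let ?G = "linear_aut_group K V"
  interpret G: group ?G by (rule group_linear_aut_group[OF V.module_axioms])
  note gD = linear_aut_groupD[OF g]
  \<comment> \<open>\<open>(c, d)\<close> is the lower row of \<open>g\<close>; it is onto because
    \<open>g\<close> reaches every \<open>j w\<close>.\<close>
  define c where "c x = q (g (i x))" for x
  define d where "d y = q (g (j y))" for y
  have c: "c \<in> LinearCombinations.module_hom K A B" and d: "d \<in> LinearCombinations.module_hom K B B"
    unfolding c_def d_def
    by (intro module_hom_comp[OF module_hom_comp[OF i gD(1)] q]
        module_hom_comp[OF module_hom_comp[OF j gD(1)] q])+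
  have "\<exists>a \<in> carrier A. \<exists>y \<in> carrier B. w = c a \<oplus>\<^bsub>B\<^esub> d y" if w: "w \<in> carrier B" for w
  proof -
    obtain v where v: "v \<in> carrier V" "g v = j w"
      using gD(2) w by (metis bij_betw_def hom_simps(10) imageE)
    have "w = q (g (i (p v) \<oplus>\<^bsub>V\<^esub> j (q v)))" using v w by (simp add: ip_jq hom_simps)
    also have "\<dots> = c (p v) \<oplus>\<^bsub>B\<^esub> d (q v)"
      using v by (simp add: c_def d_def hom_simps module_homD[OF gD(1)])
    finally show ?thesis using v by (metis hom_simps(1,4))
  qed
  then obtain b where b: "b \<in> LinearCombinations.module_hom K B A"
    and bij: "bij_betw (\<lambda>y. c (b y) \<oplus>\<^bsub>B\<^esub> d y) (carrier B) (carrier B)"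
    using shear_exists[OF A.vectorspace_axioms B.vectorspace_axioms fd c d] by blast
  have id: "(\<lambda>v. v) \<in> LinearCombinations.module_hom K V V" by (intro module_homI) simp_all
  define l0 where "l0 v = v \<oplus>\<^bsub>V\<^esub> i (b (q v))" for v
  have l0: "l0 \<in> LinearCombinations.module_hom K V V"
    unfolding l0_def
    by (intro module_hom_plus[OF V.module_axioms id] module_hom_comp[OF module_hom_comp[OF q b] i])
  note ll = module_homD[OF l0]
  have q_l0: "q (l0 v) = q v" if "v \<in> carrier V" for v
    using that b by (simp add: l0_def hom_simps module_homD)
  have b0: "b \<zero>\<^bsub>B\<^esub> = \<zero>\<^bsub>A\<^esub>" by (rule module_hom_zero[OF B.module_axioms A.module_axioms b])
  have bij_l0: "bij_betw l0 (carrier V) (carrier V)"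
  proof (rule bij_betwI[OF l0])
    fix v assume v: "v \<in> carrier V" "l0 v = \<zero>\<^bsub>V\<^esub>"
    then have "q v = \<zero>\<^bsub>B\<^esub>" using q_l0[of v] by (simp add: hom_simps)
    then show "v = \<zero>\<^bsub>V\<^esub>" using v by (simp add: l0_def b0 hom_simps)
  next
    fix w assume w: "w \<in> carrier V"
    \<comment> \<open>The inverse shear, by \<open>- b\<close>, supplies the preimage of
      \<open>w\<close>.\<close>
    define v where "v = w \<oplus>\<^bsub>V\<^esub> i (b (\<ominus>\<^bsub>B\<^esub> q w))"
    have v: "v \<in> carrier V" "q v = q w"
      using w b by (simp_all add: v_def hom_simps module_homD)
    have "i (b (\<ominus>\<^bsub>B\<^esub> q w)) \<oplus>\<^bsub>V\<^esub> i (b (q w)) = i (b (\<ominus>\<^bsub>B\<^esub> q w \<oplus>\<^bsub>B\<^esub> q w))"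
      using w b by (simp add: hom_simps module_homD del: B.M.l_neg)
    also have "\<dots> = \<zero>\<^bsub>V\<^esub>" using w by (simp add: B.M.l_neg b0 hom_simps)
    finally have "l0 v = w"
      using w b v(2) by (simp add: l0_def v_def V.M.a_assoc hom_simps module_homD)
    then show "\<exists>v \<in> carrier V. l0 v = w" using v by blast
  qed
  define l where "l = restrict l0 (carrier V)"
  have lG: "l \<in> carrier ?G"
    unfolding l_def by (rule restrict_in_linear_aut_group[OF V.module_axioms l0 bij_l0])
  then have l: "l \<in> stabilizing_auts K V q"
    using q_l0 by (simp add: stabilizing_auts_def l_def)
  \<comment> \<open>\<open>h\<close> is the lower row of \<open>g l0\<close>; its entry on
    \<open>B\<close> is \<open>c b + d\<close>, bijective by the choice of \<open>b\<close>.\<close>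
  define h where "h v = q (g (l0 v))" for v
  have h: "h \<in> LinearCombinations.module_hom K V B"
    unfolding h_def by (rule module_hom_comp[OF module_hom_comp[OF l0 gD(1)] q])
  note h_simps = module_homD[OF h] module_hom_zero[OF V.module_axioms B.module_axioms h]
  have h_j: "h (j y) = c (b y) \<oplus>\<^bsub>B\<^esub> d y" if "y \<in> carrier B" for y
    using that b
    by (simp add: h_def l0_def c_def d_def hom_simps module_homD module_homD[OF gD(1)]
        B.M.a_comm)
  \<comment> \<open>Identity row above, \<open>h\<close> below: lower triangular with invertible
    diagonal blocks.\<close>
  define r0 where "r0 v = i (p v) \<oplus>\<^bsub>V\<^esub> j (h v)" for v
  have r0: "r0 \<in> LinearCombinations.module_hom K V V"
    unfolding r0_def
    by (intro module_hom_plus[OF V.module_axioms module_hom_comp[OF p i] module_hom_comp[OF h j]])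
  have p_r0: "p (r0 v) = p v" and q_r0: "q (r0 v) = h v" if "v \<in> carrier V" for v
    using that by (simp_all add: r0_def hom_simps h_simps)
  have bij_r0: "bij_betw r0 (carrier V) (carrier V)"
  proof (rule bij_betwI[OF r0])
    fix v assume v: "v \<in> carrier V" "r0 v = \<zero>\<^bsub>V\<^esub>"
    then have pv: "p v = \<zero>\<^bsub>A\<^esub>" and hv: "h v = \<zero>\<^bsub>B\<^esub>"
      using p_r0[of v] q_r0[of v] by (simp_all add: hom_simps)
    \<comment> \<open>With \<open>p v\<close> zero, \<open>v\<close> comes from \<open>B\<close>,
      where \<open>h\<close> is the injective map \<open>c b + d\<close>.\<close>
    have "v = j (q v)" using ip_jq[OF v(1)] v pv by (simp add: hom_simps)
    then have "h (j (q v)) = h (j \<zero>\<^bsub>B\<^esub>)" using hv by (simp add: hom_simps h_simps)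
    then have "c (b (q v)) \<oplus>\<^bsub>B\<^esub> d (q v) = c (b \<zero>\<^bsub>B\<^esub>) \<oplus>\<^bsub>B\<^esub> d \<zero>\<^bsub>B\<^esub>"
      using h_j[of "q v"] h_j[of "\<zero>\<^bsub>B\<^esub>"] v(1) by (simp add: hom_simps)
    then have "q v = \<zero>\<^bsub>B\<^esub>"
      by (rule inj_onD[OF bij_betw_imp_inj_on[OF bij]]) (use v in \<open>simp_all add: hom_simps\<close>)
    then show "v = \<zero>\<^bsub>V\<^esub>" using v pv by (intro eqI) (simp_all add: hom_simps)
  next
    fix w assume w: "w \<in> carrier V"
    then have "q w \<ominus>\<^bsub>B\<^esub> h (i (p w)) \<in> carrier B" by (simp add: hom_simps h_simps)
    then obtain y where y: "y \<in> carrier B" "h (j y) = q w \<ominus>\<^bsub>B\<^esub> h (i (p w))"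
      using bij h_j by (metis (no_types, lifting) bij_betw_imp_surj_on imageE)
    \<comment> \<open>The upper component of a preimage of \<open>w\<close> has to be
      \<open>p w\<close>; \<open>y\<close> was chosen to correct the lower one.\<close>
    define v where "v = i (p w) \<oplus>\<^bsub>V\<^esub> j y"
    have v: "v \<in> carrier V" "p v = p w" using w y by (simp_all add: v_def hom_simps)
    have "h v = h (i (p w)) \<oplus>\<^bsub>B\<^esub> (q w \<ominus>\<^bsub>B\<^esub> h (i (p w)))"
      using w y by (simp add: v_def hom_simps h_simps)
    also have "\<dots> = q w"
      using w by (simp add: hom_simps h_simps B.M.minus_eq B.M.a_ac B.M.r_neg B.M.r_neg2 B.M.r_neg1)
    finally have "r0 v = w" using w v p_r0 q_r0 r0 by (intro eqI) (simp_all add: module_homD)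
    then show "\<exists>v \<in> carrier V. r0 v = w" using v by blast
  qed
  define r where "r = restrict r0 (carrier V)"
  have rG: "r \<in> carrier ?G"
    unfolding r_def by (rule restrict_in_linear_aut_group[OF V.module_axioms r0 bij_r0])
  then have r: "r \<in> stabilizing_auts K V p"
    using p_r0 by (simp add: stabilizing_auts_def r_def)
  \<comment> \<open>\<open>r\<close> has the same \<open>q\<close>-component as \<open>g l\<close>,
    so cancelling it leaves a map that fixes \<open>q\<close>.\<close>
  define m where "m = g \<otimes>\<^bsub>?G\<^esub> l \<otimes>\<^bsub>?G\<^esub> inv\<^bsub>?G\<^esub> r"
  have mG: "m \<in> carrier ?G" using g lG rG by (simp add: m_def)
  have "q (m v) = q v" if v: "v \<in> carrier V" for v
  proof -
    define u where "u = (inv\<^bsub>?G\<^esub> r) v"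
    have u: "u \<in> carrier V" using linear_aut_groupD(5)[OF G.inv_closed[OF rG] v] by (simp add: u_def)
    have ru: "r u = v" unfolding u_def by (rule linear_aut_group_inv_apply[OF V.module_axioms rG v])
    have "m v = g (l u)"
      using g lG rG v u by (simp add: m_def linear_aut_group_mult_apply u_def[symmetric])
    then have "q (m v) = h u" using u by (simp add: h_def l_def)
    also have "\<dots> = q v" using q_r0[OF u] ru u by (simp add: r_def)
    finally show ?thesis .
  qed
  then have m: "m \<in> stabilizing_auts K V q" using mG by (simp add: stabilizing_auts_def)
  have "g = m \<otimes>\<^bsub>?G\<^esub> r \<otimes>\<^bsub>?G\<^esub> inv\<^bsub>?G\<^esub> l"
    using g lG rG by (simp add: m_def G.m_assoc)
  then show ?thesis
    using that[OF m r subgroup.m_inv_closed[OF subgroup_stabilizing_auts[OF V.module_axioms] l]]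
    by blast
qed

text \<open>The obstruction to two factors: the lower right block of \<open>l r\<close> is that of
  \<open>r\<close>, because \<open>l\<close> fixes \<open>q\<close>, and it is injective because
  \<open>r\<close> is injective and fixes \<open>p\<close>.\<close>

lemma stabilizing_auts_mult_kernel:
  assumes "l \<in> stabilizing_auts K V q" "r \<in> stabilizing_auts K V p" "v \<in> carrier V"
    "p v = \<zero>\<^bsub>A\<^esub>" "q ((l \<otimes>\<^bsub>linear_aut_group K V\<^esub> r) v) = \<zero>\<^bsub>B\<^esub>"
  shows "v = \<zero>\<^bsub>V\<^esub>"
proof -
  have rl: "r \<in> carrier (linear_aut_group K V)" "l \<in> carrier (linear_aut_group K V)"
    using assms(1,2) by (simp_all add: stabilizing_auts_def)
  note rD = linear_aut_groupD[OF rl(1)]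
  have r0: "r \<zero>\<^bsub>V\<^esub> = \<zero>\<^bsub>V\<^esub>"
    by (rule module_hom_zero[OF V.module_axioms V.module_axioms rD(1)])
  have "q (r v) = \<zero>\<^bsub>B\<^esub>"
    using assms rl rD(5) by (simp add: linear_aut_group_mult_apply) (simp add: stabilizing_auts_def)
  moreover have "p (r v) = \<zero>\<^bsub>A\<^esub>" using assms by (simp add: stabilizing_auts_def)
  ultimately have "r v = r \<zero>\<^bsub>V\<^esub>"
    unfolding r0 using assms(3) rD(5) by (intro eqI) (simp_all add: hom_simps)
  then show ?thesis using rD(4) assms(3) by (auto dest: inj_onD)
qed

end

section \<open>The alternation diameter\<close>

lemma direct_sum_simps:
  "carrier (direct_sum A B) = carrier A \<times> carrier B"
  "\<zero>\<^bsub>direct_sum A B\<^esub> = (\<zero>\<^bsub>A\<^esub>, \<zero>\<^bsub>B\<^esub>)"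
  "u \<oplus>\<^bsub>direct_sum A B\<^esub> v = (fst u \<oplus>\<^bsub>A\<^esub> fst v, snd u \<oplus>\<^bsub>B\<^esub> snd v)"
  "c \<odot>\<^bsub>direct_sum A B\<^esub> v = (c \<odot>\<^bsub>A\<^esub> fst v, c \<odot>\<^bsub>B\<^esub> snd v)"
  by (simp_all add: direct_sum_def)

lemma biproduct_direct_sum:
  fixes A :: "('a, 'b) module" and B :: "('a, 'c) module"
  assumes "vectorspace K A" "vectorspace K B"
  shows "biproduct K (direct_sum A B) A B fst snd (inj1 A B) (inj2 A B)"
    and "biproduct K (direct_sum A B) B A snd fst (inj2 A B) (inj1 A B)"
proof -
  interpret A: vectorspace K A by fact
  interpret B: vectorspace K B by fact
  interpret AB: vectorspace K "direct_sum A B" using assms by (rule direct_sum_is_vs)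
  have "fst \<in> LinearCombinations.module_hom K (direct_sum A B) A"
    "snd \<in> LinearCombinations.module_hom K (direct_sum A B) B"
    "inj1 A B \<in> LinearCombinations.module_hom K A (direct_sum A B)"
    "inj2 A B \<in> LinearCombinations.module_hom K B (direct_sum A B)"
    by (intro module_homI; auto simp: direct_sum_simps inj1_def inj2_def)+
  then show "biproduct K (direct_sum A B) A B fst snd (inj1 A B) (inj2 A B)"
    "biproduct K (direct_sum A B) B A snd fst (inj2 A B) (inj1 A B)"
    by (unfold_locales; auto simp: direct_sum_simps inj1_def inj2_def)+
qed

lemma aut_left_eq: "aut_left K A B = stabilizing_auts K (direct_sum A B) snd"
  and aut_right_eq: "aut_right K A B = stabilizing_auts K (direct_sum A B) fst"
  by (simp_all add: aut_left_def aut_right_def stabilizing_auts_def aut_prod_def)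

lemma
  assumes "vectorspace K A" "vectorspace K B"
  shows group_aut_prod: "group (aut_prod K A B)"
    and subgroup_aut_left: "subgroup (aut_left K A B) (aut_prod K A B)"
    and subgroup_aut_right: "subgroup (aut_right K A B) (aut_prod K A B)"
proof -
  interpret vectorspace K "direct_sum A B" using assms by (rule direct_sum_is_vs)
  show "group (aut_prod K A B)" "subgroup (aut_left K A B) (aut_prod K A B)"
    "subgroup (aut_right K A B) (aut_prod K A B)"
    unfolding aut_left_eq aut_right_eq aut_prod_def
    by (rule group_linear_aut_group subgroup_stabilizing_auts; rule module_axioms)+
qed

lemma set_mult3_subset_carrier:
  assumes "group G" "subgroup H G" "subgroup J G"
  shows "H <#>\<^bsub>G\<^esub> J <#>\<^bsub>G\<^esub> H \<subseteq> carrier G"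
proof -
  interpret group G by fact
  show ?thesis
    using assms(2,3) by (intro setmult_subset_G subgroup.subset)
qed

text \<open>Each of the two biproduct structures on \<open>direct_sum A B\<close> yields one
  factorization; with the factors exchanged, the rank argument takes place in \<open>A\<close>,
  whose finite dimension then enters.\<close>

lemma aut_prod_factorization:
  assumes "A \<in> fin_dim_spaces K" "B \<in> fin_dim_spaces K"
  defines "G \<equiv> aut_prod K A B" and "L \<equiv> aut_left K A B" and "R \<equiv> aut_right K A B"
  shows "carrier G = L <#>\<^bsub>G\<^esub> R <#>\<^bsub>G\<^esub> L" "carrier G = R <#>\<^bsub>G\<^esub> L <#>\<^bsub>G\<^esub> R"
proof -
  have vs: "vectorspace K A" "vectorspace K B"
    and fd: "vectorspace.fin_dim K A" "vectorspace.fin_dim K B"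
    using assms(1,2) by (simp_all add: fin_dim_spaces_def)
  note sub = group_aut_prod[OF vs] subgroup_aut_left[OF vs] subgroup_aut_right[OF vs]
  have "g \<in> L <#>\<^bsub>G\<^esub> R <#>\<^bsub>G\<^esub> L" if g: "g \<in> carrier G" for g
  proof -
    obtain l r l' where "l \<in> L" "r \<in> R" "l' \<in> L" "g = l \<otimes>\<^bsub>G\<^esub> r \<otimes>\<^bsub>G\<^esub> l'"
      using g unfolding G_def L_def R_def aut_left_eq aut_right_eq aut_prod_def
      by (rule biproduct.factorization[OF biproduct_direct_sum(1)[OF vs] fd(2)])
    then show ?thesis by (auto simp: set_mult_def)
  qed
  moreover have "g \<in> R <#>\<^bsub>G\<^esub> L <#>\<^bsub>G\<^esub> R" if g: "g \<in> carrier G" for g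
  proof -
    obtain l r r' where "r \<in> R" "l \<in> L" "r' \<in> R" "g = r \<otimes>\<^bsub>G\<^esub> l \<otimes>\<^bsub>G\<^esub> r'"
      using g unfolding G_def L_def R_def aut_left_eq aut_right_eq aut_prod_def
      by (rule biproduct.factorization[OF biproduct_direct_sum(2)[OF vs] fd(1)])
    then show ?thesis by (auto simp: set_mult_def)
  qed
  ultimately show "carrier G = L <#>\<^bsub>G\<^esub> R <#>\<^bsub>G\<^esub> L" "carrier G = R <#>\<^bsub>G\<^esub> L <#>\<^bsub>G\<^esub> R"
    using set_mult3_subset_carrier[OF sub(1,2,3)] set_mult3_subset_carrier[OF sub(1,3,2)]
    unfolding G_def L_def R_def by blast+
qed

text \<open>This puts the alternation diameter in its defined case.\<close>

lemma generate_aut_prod: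
  assumes "A \<in> fin_dim_spaces K" "B \<in> fin_dim_spaces K"
  shows "generate (aut_prod K A B) (aut_left K A B \<union> aut_right K A B) = carrier (aut_prod K A B)"
    (is "generate ?G (?L \<union> ?R) = _")
proof
  have vs: "vectorspace K A" "vectorspace K B" using assms by (simp_all add: fin_dim_spaces_def)
  interpret group ?G by (rule group_aut_prod[OF vs])
  show "generate ?G (?L \<union> ?R) \<subseteq> carrier ?G"
    using subgroup_aut_left[OF vs] subgroup_aut_right[OF vs]
    by (intro generate_incl) (auto dest: subgroup.subset)
  have "?L <#>\<^bsub>?G\<^esub> ?R <#>\<^bsub>?G\<^esub> ?L \<subseteq> generate ?G (?L \<union> ?R)"
    by (auto simp: set_mult_def intro!: generate.eng intro: generate.incl)
  then show "carrier ?G \<subseteq> generate ?G (?L \<union> ?R)"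
    using aut_prod_factorization(1)[OF assms] by simp
qed

text \<open>The word \<open>[l, r, l']\<close> shows that 3 is among the bounds over which the
  infimum is taken.\<close>

lemma alternation_diameter_le_3:
  assumes "A \<in> fin_dim_spaces K" "B \<in> fin_dim_spaces K"
  obtains d where "alternation_diameter K A B = Some d" "d \<le> 3"
proof -
  let ?G = "aut_prod K A B" let ?L = "aut_left K A B" let ?R = "aut_right K A B"
  let ?S = "?L \<union> ?R"
  have vs: "vectorspace K A" "vectorspace K B" using assms by (simp_all add: fin_dim_spaces_def)
  interpret group ?G by (rule group_aut_prod[OF vs])
  have S: "?L \<subseteq> carrier ?G" "?R \<subseteq> carrier ?G"
    using subgroup_aut_left[OF vs] subgroup_aut_right[OF vs] by (auto dest: subgroup.subset)
  let ?D = "{enat d | d. \<forall>g \<in> carrier ?G. \<exists>gs. set gs \<subseteq> ?S \<and> length gs \<le> d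
      \<and> g = foldr (mult ?G) gs \<one>\<^bsub>?G\<^esub>}"
  have "\<exists>gs. set gs \<subseteq> ?S \<and> length gs \<le> 3 \<and> g = foldr (mult ?G) gs \<one>\<^bsub>?G\<^esub>"
    if g: "g \<in> carrier ?G" for g
  proof -
    obtain l r l' where lrl: "l \<in> ?L" "r \<in> ?R" "l' \<in> ?L"
      "g = l \<otimes>\<^bsub>?G\<^esub> r \<otimes>\<^bsub>?G\<^esub> l'"
      using g aut_prod_factorization(1)[OF assms] by (auto simp: set_mult_def)
    then have "l \<in> carrier ?G" "r \<in> carrier ?G" "l' \<in> carrier ?G" using S by auto
    then have "g = foldr (mult ?G) [l, r, l'] \<one>\<^bsub>?G\<^esub>" using lrl(4) by (simp add: m_assoc)
    then show ?thesis using lrl by (intro exI[of _ "[l, r, l']"]) simp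
  qed
  then have "enat 3 \<in> ?D" by blast
  then have "Inf ?D \<le> enat 3" by (rule Inf_lower)
  then show ?thesis
    using that generate_aut_prod[OF assms]
    by (simp add: alternation_diameter_def Let_def numeral_eq_enat)
qed

section \<open>The lower bound from the swap of two equal factors\<close>

lemma swap_in_aut_prod:
  assumes "vectorspace K V"
  shows "restrict prod.swap (carrier V \<times> carrier V) \<in> carrier (aut_prod K V V)"
proof -
  interpret vectorspace K "direct_sum V V" using assms assms by (rule direct_sum_is_vs)
  have "prod.swap \<in> LinearCombinations.module_hom K (direct_sum V V) (direct_sum V V)"
    by (intro module_homI) (auto simp: direct_sum_simps)
  moreover have "bij_betw prod.swap (carrier (direct_sum V V)) (carrier (direct_sum V V))"
    by (auto simp: direct_sum_simps bij_betw_def inj_on_def)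
  ultimately show ?thesis
    using restrict_in_linear_aut_group[OF module_axioms]
    by (simp add: aut_prod_def direct_sum_simps)
qed

text \<open>The swap sends \<open>(0, v)\<close> to \<open>(v, 0)\<close>, so its lower right block
  is zero, whereas that of \<open>l r\<close> is injective. The other order follows with the two
  factors of the direct sum exchanged.\<close>

lemma swap_not_product:
  assumes V: "vectorspace K V" and v: "v \<in> carrier V" "v \<noteq> \<zero>\<^bsub>V\<^esub>"
    and l: "l \<in> aut_left K V V" and r: "r \<in> aut_right K V V"
  shows "restrict prod.swap (carrier V \<times> carrier V) \<noteq> l \<otimes>\<^bsub>aut_prod K V V\<^esub> r"
    and "restrict prod.swap (carrier V \<times> carrier V) \<noteq> r \<otimes>\<^bsub>aut_prod K V V\<^esub> l"
proof -
  interpret V: vectorspace K V by fact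
  note lr = l[unfolded aut_left_eq] r[unfolded aut_right_eq]
  show "restrict prod.swap (carrier V \<times> carrier V) \<noteq> l \<otimes>\<^bsub>aut_prod K V V\<^esub> r"
  proof
    assume *: "restrict prod.swap (carrier V \<times> carrier V) = l \<otimes>\<^bsub>aut_prod K V V\<^esub> r"
    have "(\<zero>\<^bsub>V\<^esub>, v) = \<zero>\<^bsub>direct_sum V V\<^esub>"
      by (rule biproduct.stabilizing_auts_mult_kernel[OF biproduct_direct_sum(1)[OF V V] lr])
        (use v in \<open>simp_all add: *[unfolded aut_prod_def, symmetric] direct_sum_simps\<close>)
    then show False using v by (simp add: direct_sum_simps)
  qed
  show "restrict prod.swap (carrier V \<times> carrier V) \<noteq> r \<otimes>\<^bsub>aut_prod K V V\<^esub> l"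
  proof
    assume *: "restrict prod.swap (carrier V \<times> carrier V) = r \<otimes>\<^bsub>aut_prod K V V\<^esub> l"
    have "(v, \<zero>\<^bsub>V\<^esub>) = \<zero>\<^bsub>direct_sum V V\<^esub>"
      by (rule biproduct.stabilizing_auts_mult_kernel
          [OF biproduct_direct_sum(2)[OF V V] lr(2,1)])
        (use v in \<open>simp_all add: *[unfolded aut_prod_def, symmetric] direct_sum_simps\<close>)
    then show False using v by (simp add: direct_sum_simps)
  qed
qed

text \<open>Short words are padded with the neutral element and two neighbours from one subgroup
  merge into one, so only the two alternating shapes of length 2 remain.\<close>

lemma (in group) product_of_length_le_2:
  assumes L: "subgroup L G" and R: "subgroup R G"
    and gs: "set gs \<subseteq> L \<union> R" "length gs \<le> 2"
  obtains l r where "l \<in> L" "r \<in> R"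
    "foldr (mult G) gs \<one> = l \<otimes> r \<or> foldr (mult G) gs \<one> = r \<otimes> l"
proof -
  note LR = subgroup.mem_carrier[OF L] subgroup.mem_carrier[OF R]
  have one: "\<one> \<in> L" "\<one> \<in> R" using L R by (simp_all add: subgroup.one_closed)
  consider "gs = []" | a where "gs = [a]" | a b where "gs = [a, b]"
    using gs(2) by (cases gs; cases "tl gs") auto
  then show ?thesis
  proof cases
    case 1
    then show ?thesis using that[OF one] by simp
  next
    case 2
    then show ?thesis using gs(1) LR that[of a \<one>] that[of \<one> a] one by auto
  next
    case 3
    have "a \<otimes> b \<in> L" if "a \<in> L" "b \<in> L" using that L by (simp add: subgroup.m_closed)
    moreover have "a \<otimes> b \<in> R" if "a \<in> R" "b \<in> R" using that R by (simp add: subgroup.m_closed)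
    ultimately show ?thesis
      using 3 gs(1) LR that[of "a \<otimes> b" \<one>] that[of \<one> "a \<otimes> b"] that[of a b] that[of b a] one by auto
  qed
qed

text \<open>Every admissible bound must accommodate the swap and is therefore at least 3; an empty
  set of bounds, with infinite infimum, is covered as well.\<close>

lemma alternation_diameter_self_ge_3:
  assumes V: "vectorspace K V" and v: "v \<in> carrier V" "v \<noteq> \<zero>\<^bsub>V\<^esub>"
    and d: "alternation_diameter K V V = Some d"
  shows "3 \<le> d"
proof -
  let ?G = "aut_prod K V V" let ?S = "aut_left K V V \<union> aut_right K V V"
  interpret group ?G by (rule group_aut_prod[OF V V])
  have "enat 3 \<le> e" if "e \<in> {enat d | d. \<forall>g \<in> carrier ?G. \<exists>gs. set gs \<subseteq> ?S \<and> length gs \<le> d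
      \<and> g = foldr (mult ?G) gs \<one>\<^bsub>?G\<^esub>}" for e
  proof -
    from that obtain n gs where n: "e = enat n" "set gs \<subseteq> ?S" "length gs \<le> n"
      "restrict prod.swap (carrier V \<times> carrier V) = foldr (mult ?G) gs \<one>\<^bsub>?G\<^esub>"
      using swap_in_aut_prod[OF V] by blast
    have "\<not> length gs \<le> 2"
      using product_of_length_le_2[OF subgroup_aut_left[OF V V] subgroup_aut_right[OF V V] n(2)]
        swap_not_product[OF V v] n(4) by metis
    then show ?thesis using n(1,3) by simp
  qed
  then have "enat 3 \<le> Inf {enat d | d. \<forall>g \<in> carrier ?G. \<exists>gs. set gs \<subseteq> ?S \<and> length gs \<le> d
      \<and> g = foldr (mult ?G) gs \<one>\<^bsub>?G\<^esub>}" by (rule Inf_greatest)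
  then show ?thesis
    using d by (auto simp: alternation_diameter_def Let_def numeral_eq_enat split: if_splits)
qed

theorem theorem6:
  fixes K :: "('a, 'r) ring_scheme"
  assumes "field K"
    and "universe_of_spaces K TYPE('u)"
  shows "category_alternation_diameter K (fin_dim_spaces K :: ('a, 'u) module set) = Some 3
    \<and> (\<forall>(A :: ('a, 'b) module) (B :: ('a, 'c) module).
         A \<in> fin_dim_spaces K \<and> B \<in> fin_dim_spaces K \<longrightarrow>
         (let G = aut_prod K A B; L = aut_left K A B; R = aut_right K A B in
          carrier G = L <#>\<^bsub>G\<^esub> R <#>\<^bsub>G\<^esub> L \<and> carrier G = R <#>\<^bsub>G\<^esub> L <#>\<^bsub>G\<^esub> R))"
proof -
  let ?C = "fin_dim_spaces K :: ('a, 'u) module set"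
  have diam: "\<exists>d. alternation_diameter K A B = Some d \<and> d \<le> 3" if "A \<in> ?C" "B \<in> ?C" for A B
    by (rule alternation_diameter_le_3[OF that]) blast
  \<comment> \<open>Dimension 1 serves to provide a nonzero vector, which the swap argument on
    \<open>V \<times> V\<close> requires.\<close>
  obtain V where V: "V \<in> ?C" "vectorspace.dim K V = 1"
    using assms(2) unfolding universe_of_spaces_def by blast
  interpret V: vectorspace K V using V(1) by (simp add: fin_dim_spaces_def)
  obtain v where v: "v \<in> carrier V" "v \<noteq> \<zero>\<^bsub>V\<^esub>"
  proof (rule ccontr)
    assume "\<not> thesis"
    then have "carrier V = {\<zero>\<^bsub>V\<^esub>}" using that by blast
    \<comment> \<open>Here the zero vector alone would span \<open>V\<close>, giving dimension
      0.\<close>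
    then have "V.gen_set {\<zero>\<^bsub>V\<^esub>}" using V.in_own_span[of "{\<zero>\<^bsub>V\<^esub>}"] V.span_is_subset2[of "{\<zero>\<^bsub>V\<^esub>}"] by auto
    then show False using V.dim0I V(2) by simp
  qed
  have ge: "3 \<le> the (alternation_diameter K V V)"
    using alternation_diameter_self_ge_3[OF V.vectorspace_axioms v] diam[OF V(1,1)] by auto
  have "(SUP (A, B) \<in> ?C \<times> ?C. the (alternation_diameter K A B)) = 3"
  proof (rule antisym)
    show "(SUP (A, B) \<in> ?C \<times> ?C. the (alternation_diameter K A B)) \<le> 3"
      using diam by (intro SUP_least) fastforce
    \<comment> \<open>The pair \<open>(V, V)\<close> attains the bound.\<close>
    show "3 \<le> (SUP (A, B) \<in> ?C \<times> ?C. the (alternation_diameter K A B))"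
      using ge V(1) by (intro SUP_upper2[of "(V, V)"]) auto
  qed
  then have "category_alternation_diameter K ?C = Some 3"
    using diam by (force simp: category_alternation_diameter_def)
  then show ?thesis
    unfolding Let_def using aut_prod_factorization by blast
qed

end
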